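(* Let $\mathbb F_q$ be a finite field with $q$ elements and let $a,b$ be integers with $0\le b\le a\le q-2$. Let $\square\subseteq\mathbb R^2$ be the polytope with vertices $(0,0),(a,0),(b,q-2),(0,q-2)$, and let $U=\mathbb Z^2\cap\square$. Then: (1) For every non-zero $f\in\mathbb F_q[U]$, the number of zeros of $f$ on $T(\mathbb F_q)$ is less than or equal to $(q-1)^2-(q-1-a)$. (2) The toric code $C_\square$ over $\mathbb F_q$ has (a) length equal to $(q-1)^2$; (b) dimension equal to $\#(\mathbb Z^2\cap\square)=\dfrac{(q-1)(a+b+1)+\gcd(a-b,q-2)+1}{2}$; (c) minimum distance greater than or equal to $q-1-a$.
   Context: For a finite set $U\subseteq\mathbb Z^2$, $\mathbb F_q[U]$ is the $\mathbb F_q$-linear span of the monomials $X_1^{u_1}X_2^{u_2}$, $(u_1,u_2)\in U$, in $\mathbb F_q[X_1^{\pm1},X_2^{\pm1}]$. $T(\mathbb F_q)=(\mathbb F_q^* )^2$. For $U=\mathbb Z^2\cap\square$, the toric code $C_\square$ is the image of the evaluation map $\mathbb F_q[U]\to\mathbb F_q^{|T(\mathbb F_q)|}$, $f\mapsto(f(P))_{P\in T(\mathbb F_q)}$. The minimum distance of a linear code is the minimal number of non-zero coordinates of a non-zero codeword. *)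

theory Defs
  imports "HOL-Analysis.Analysis" "HOL-Library.Poly_Mapping"
begin

text \<open>
  The Laurent polynomial ring \<open>K[X\<^sub>1\<^sup>\<plusminus>\<^sup>1, X\<^sub>2\<^sup>\<plusminus>\<^sup>1]\<close> is the monoid algebra of \<open>\<int>\<^sup>2\<close> over \<open>K\<close>:
  a finitely supported map sends an exponent vector \<open>(u\<^sub>1, u\<^sub>2)\<close> to the coefficient of
  \<open>X\<^sub>1\<^bsup>u\<^sub>1\<^esup> X\<^sub>2\<^bsup>u\<^sub>2\<^esup>\<close>.
\<close>

type_synonym 'k laurent2 = "(int \<times> int) \<Rightarrow>\<^sub>0 'k"

definition laurent_scale :: "'k::field \<Rightarrow> 'k laurent2 \<Rightarrow> 'k laurent2" where
  "laurent_scale c f = Poly_Mapping.map ((*) c) f"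

lemma lookup_laurent_scale [simp]:
  "Poly_Mapping.lookup (laurent_scale c f) u = c * Poly_Mapping.lookup f u"
  by (simp add: laurent_scale_def Poly_Mapping.map.rep_eq when_def)

global_interpretation laurent: vector_space laurent_scale
  by unfold_locales (auto intro!: poly_mapping_eqI simp: lookup_add algebra_simps)

definition laurent_monom :: "int \<times> int \<Rightarrow> 'k::field laurent2" where
  "laurent_monom u = Poly_Mapping.single u 1"

definition laurent_span :: "(int \<times> int) set \<Rightarrow> 'k::field laurent2 set" where
  "laurent_span U = laurent.span (laurent_monom ` U)"

definition laurent_eval :: "'k::field laurent2 \<Rightarrow> 'k \<times> 'k \<Rightarrow> 'k" where
  "laurent_eval f P =
     (\<Sum>u\<in>Poly_Mapping.keys f.
        Poly_Mapping.lookup f u * fst P powi fst u * snd P powi snd u)"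

definition torus :: "('k::field \<times> 'k) set" where
  "torus = {P. fst P \<noteq> 0 \<and> snd P \<noteq> 0}"

text \<open>The points of the torus as a type, so that they can index the coordinates of a vector.\<close>

typedef (overloaded) 'k torus_point = "torus :: ('k::field \<times> 'k) set"
  unfolding torus_def by (rule exI[of _ "(1, 1)"]) simp

instance torus_point :: ("{field, finite}") finite
proof
  have "inj (Rep_torus_point :: 'a torus_point \<Rightarrow> _)"
    by (simp add: inj_def Rep_torus_point_inject)
  then show "finite (UNIV :: 'a torus_point set)"
    by (rule finite_imageD[rotated]) simp
qed

text \<open>Codes of length \<open>n\<close> are sets of vectors with an index type of cardinality \<open>n\<close>.\<close>

definition code_length :: "('k::field ^ 'n) set \<Rightarrow> nat" where
  "code_length C = CARD('n)"

definition hamming_weight :: "'k::field ^ 'n \<Rightarrow> nat" where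
  "hamming_weight c = card {i. c $ i \<noteq> 0}"

text \<open>Only meaningful for a code with a non-zero codeword, so that the infimum on \<open>nat\<close> is a minimum.\<close>

definition min_distance :: "('k::field ^ 'n) set \<Rightarrow> nat" where
  "min_distance C = Inf (hamming_weight ` (C - {0}))"

definition lattice_points :: "(real \<times> real) set \<Rightarrow> (int \<times> int) set" where
  "lattice_points S = {u. (of_int (fst u), of_int (snd u)) \<in> S}"

definition eval_map :: "'k::{field,finite} laurent2 \<Rightarrow> 'k ^ 'k torus_point" where
  "eval_map f = (\<chi> P. laurent_eval f (Rep_torus_point P))"

definition toric_code :: "(real \<times> real) set \<Rightarrow> ('k::{field,finite} ^ 'k torus_point) set" where
  "toric_code S = eval_map ` laurent_span (lattice_points S)"

end

theory Submission
  imports Defs "HOL-Computational_Algebra.Polynomial"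
begin

text \<open>
  Write \<open>f = (\<Sum>j. p\<^sub>j(X\<^sub>1) X\<^sub>2\<^sup>j)\<close> with \<open>deg p\<^sub>j \<le> a\<close> and \<open>j \<le> q - 2\<close>. If \<open>p\<^sub>j \<noteq> 0\<close>, then at least
  \<open>q - 1 - a\<close> units \<open>x\<close> are not roots of \<open>p\<^sub>j\<close>, and for each of them \<open>f(x, X\<^sub>2)\<close> is a non-zero
  polynomial of degree at most \<open>q - 2\<close>, hence does not vanish on all \<open>q - 1\<close> units. So every
  non-zero \<open>f\<close> has at least \<open>q - 1 - a \<ge> 1\<close> non-zeros on the torus, which bounds the weights
  and makes the evaluation map injective. The lattice points are counted by rows; the floors
  that occur are summed by pairing the rows \<open>y\<close> and \<open>q - 2 - y\<close>.
\<close>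

section \<open>Evaluation of Laurent polynomials and linear algebra of monomials\<close>

lemma laurent_eval_superset:
  assumes "finite A" "Poly_Mapping.keys f \<subseteq> A"
  shows "laurent_eval f P =
    (\<Sum>u\<in>A. Poly_Mapping.lookup f u * fst P powi fst u * snd P powi snd u)"
  unfolding laurent_eval_def
  by (rule sum.mono_neutral_left) (use assms in \<open>auto simp: in_keys_iff\<close>)

lemma laurent_eval_add: "laurent_eval (f + g) P = laurent_eval f P + laurent_eval g P"
proof -
  let ?A = "Poly_Mapping.keys f \<union> Poly_Mapping.keys g"
  have "Poly_Mapping.keys (f + g) \<subseteq> ?A"
    by (rule Poly_Mapping.keys_add)
  then show ?thesis
    by (simp add: laurent_eval_superset[of ?A] lookup_add algebra_simps sum.distrib)
qed

lemma laurent_eval_scale: "laurent_eval (laurent_scale c f) P = c * laurent_eval f P"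
proof -
  have "Poly_Mapping.keys (laurent_scale c f) \<subseteq> Poly_Mapping.keys f"
    by (auto simp: in_keys_iff)
  then show ?thesis
    by (simp add: laurent_eval_superset[of "Poly_Mapping.keys f"] sum_distrib_left algebra_simps)
qed

text \<open>The polynomials supported in \<open>U\<close> form a subspace containing the monomials,
  so the span lies inside it.\<close>

lemma keys_laurent_span:
  fixes f :: "'k::field laurent2"
  assumes "f \<in> laurent_span U"
  shows "Poly_Mapping.keys f \<subseteq> U"
proof -
  have "laurent_span U \<subseteq> {f :: 'k laurent2. Poly_Mapping.keys f \<subseteq> U}"
    unfolding laurent_span_def
  proof (rule laurent.span_minimal)
    show "laurent_monom ` U \<subseteq> {f :: 'k laurent2. Poly_Mapping.keys f \<subseteq> U}"
      by (auto simp: laurent_monom_def split: if_splits)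
    show "laurent.subspace {f :: 'k laurent2. Poly_Mapping.keys f \<subseteq> U}"
    proof (rule laurent.subspaceI)
      fix f g :: "'k laurent2"
      assume "f \<in> {f. Poly_Mapping.keys f \<subseteq> U}" "g \<in> {f. Poly_Mapping.keys f \<subseteq> U}"
      then show "f + g \<in> {f. Poly_Mapping.keys f \<subseteq> U}"
        using Poly_Mapping.keys_add[of f g] by blast
    qed (auto simp: in_keys_iff subset_iff)
  qed
  with assms show ?thesis by auto
qed

lemma inj_laurent_monom: "inj (laurent_monom :: int \<times> int \<Rightarrow> 'k::field laurent2)"
  by (auto simp: inj_def laurent_monom_def dest!: arg_cong[of _ _ Poly_Mapping.keys])

text \<open>The support of a monomial is its own exponent \<open>u\<close>, which rules out
  membership in the span of the monomials with exponents in \<open>U - {u}\<close>.\<close>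

lemma independent_laurent_monoms:
  "laurent.independent (laurent_monom ` U :: 'k::field laurent2 set)"
proof -
  have "laurent_monom u \<notin> laurent.span (laurent_monom ` U - {laurent_monom u :: 'k laurent2})" for u
  proof -
    have "laurent_monom ` U - {laurent_monom u :: 'k laurent2} = laurent_monom ` (U - {u})"
      by (auto simp: inj_eq[OF inj_laurent_monom])
    moreover have "(laurent_monom u :: 'k laurent2) \<notin> laurent_span (U - {u})"
      using keys_laurent_span[of "laurent_monom u :: 'k laurent2" "U - {u}"]
      by (auto simp: laurent_monom_def)
    ultimately show ?thesis by (simp add: laurent_span_def)
  qed
  then show ?thesis by (auto simp: laurent.dependent_def)
qed

section \<open>Non-zeros of polynomials on the torus\<close>

lemma card_nonzero: "card {x :: 'k::{field,finite}. x \<noteq> 0} = CARD('k) - 1"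
proof -
  have "{x :: 'k. x \<noteq> 0} = UNIV - {0}" by auto
  then show ?thesis by (simp add: card_Diff_subset)
qed

lemma card_torus: "card (torus :: ('k::{field,finite} \<times> 'k) set) = (CARD('k) - 1)\<^sup>2"
proof -
  have prod: "(torus :: ('k \<times> 'k) set) = {x. x \<noteq> 0} \<times> {x. x \<noteq> 0}"
    by (auto simp: torus_def)
  show ?thesis
    unfolding prod card_cartesian_product card_nonzero power2_eq_square ..
qed

text \<open>At most \<open>m\<close> of the q - 1 units can be roots. For m \<ge> q - 1 the
  truncated subtraction makes the bound trivial.\<close>

lemma poly_nonzero_on_units:
  fixes p :: "'k::{field,finite} poly"
  assumes "p \<noteq> 0" "degree p \<le> m"
  shows "CARD('k) - 1 - m \<le> card {x. x \<noteq> 0 \<and> poly p x \<noteq> 0}"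
proof -
  have "card {x :: 'k. x \<noteq> 0} \<le> card ({x. x \<noteq> 0 \<and> poly p x \<noteq> 0} \<union> {x. poly p x = 0})"
    by (rule card_mono) auto
  also have "\<dots> \<le> card {x. x \<noteq> 0 \<and> poly p x \<noteq> 0} + card {x. poly p x = 0}"
    by (rule card_Un_le)
  also have "card {x. poly p x = 0} \<le> m"
    using card_poly_roots_bound[OF assms(1)] assms(2) by linarith
  finally show ?thesis by (simp add: card_nonzero)
qed

text \<open>The only geometric input is a bounding box for the support, which the trapezoid will
  supply. The bound on \<open>n\<close> says that a slice in the second variable has degree less
  than the number of units, so a non-zero slice has a non-zero value at some unit.\<close>

lemma laurent_nonzeros_ge:
  fixes f :: "'k::{field,finite} laurent2"
  assumes f: "f \<noteq> 0" and keys: "Poly_Mapping.keys f \<subseteq> {0..int m} \<times> {0..int n}"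
    and n: "n + 1 < CARD('k)"
  shows "CARD('k) - 1 - m \<le> card {P \<in> torus. laurent_eval f P \<noteq> 0}"
proof -
  \<comment> \<open>\<open>p j\<close> is the coefficient of \<open>X\<^sub>2\<close> to the power
    \<open>j\<close>, an ordinary polynomial in \<open>X\<^sub>1\<close>; \<open>r x\<close> is the
    slice of \<open>f\<close> at first coordinate \<open>x\<close>, a polynomial in
    \<open>X\<^sub>2\<close>.\<close>
  define p where "p j = (\<Sum>i\<le>m. monom (Poly_Mapping.lookup f (int i, int j)) i)" for j
  define r where "r x = (\<Sum>j\<le>n. monom (poly (p j) x) j)" for x
  have eval: "laurent_eval f (x, y) = poly (r x) y" for x y
  proof -
    \<comment> \<open>Exponents in the box are non-negative, so reindexing by naturals turns
      \<open>powi\<close> into ordinary powers.\<close>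
    have bij: "{0..int m} \<times> {0..int n} = map_prod int int ` ({..m} \<times> {..n})"
      by (auto simp: image_iff) (metis atMost_iff nat_le_iff nonneg_int_cases nat_int of_nat_le_iff)+
    have inj: "inj_on (map_prod int int) ({..m} \<times> {..n})"
      by (auto simp: inj_on_def)
    have "laurent_eval f (x, y) = (\<Sum>u\<in>{0..int m} \<times> {0..int n}.
        Poly_Mapping.lookup f u * x powi fst u * y powi snd u)"
      using laurent_eval_superset[OF _ keys, of "(x, y)"] by simp
    also have "\<dots> = (\<Sum>(i, j)\<in>{..m} \<times> {..n}.
        Poly_Mapping.lookup f (int i, int j) * x ^ i * y ^ j)"
      unfolding bij sum.reindex[OF inj] by (intro sum.cong) auto
    also have "\<dots> = (\<Sum>i\<le>m. \<Sum>j\<le>n. Poly_Mapping.lookup f (int i, int j) * x ^ i * y ^ j)"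
      by (simp add: sum.cartesian_product)
    also have "\<dots> = poly (r x) y"
      unfolding r_def p_def
      by (subst sum.swap) (simp add: poly_sum poly_monom sum_distrib_right)
    finally show ?thesis .
  qed
  obtain i j where ij: "Poly_Mapping.lookup f (int i, int j) \<noteq> 0" "i \<le> m" "j \<le> n"
  proof -
    obtain u where "u \<in> Poly_Mapping.keys f" using f by (metis ex_in_conv keys_eq_empty)
    with keys have "0 \<le> fst u" "fst u \<le> int m" "0 \<le> snd u" "snd u \<le> int n"
      "Poly_Mapping.lookup f (fst u, snd u) \<noteq> 0"
      by (auto simp: in_keys_iff)
    then show ?thesis
      by (intro that[of "nat (fst u)" "nat (snd u)"]) auto
  qed
  have coeffp: "coeff (p j) i = Poly_Mapping.lookup f (int i, int j)"
    using ij by (simp add: p_def coeff_sum)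
  have coeffr: "coeff (r x) j = poly (p j) x" for x
    using ij by (simp add: r_def coeff_sum)
  have pj: "p j \<noteq> 0" using coeffp ij by auto
  have degp: "degree (p j) \<le> m"
    unfolding p_def by (intro degree_sum_le) (auto intro: order_trans[OF degree_monom_le])
  have degr: "degree (r x) \<le> n" for x
    unfolding r_def by (intro degree_sum_le) (auto intro: order_trans[OF degree_monom_le])
  \<comment> \<open>One non-zero of \<open>f\<close> above each good \<open>x\<close> suffices, so
    non-zeros are counted through their first coordinates.\<close>
  have sub: "{x. x \<noteq> 0 \<and> poly (p j) x \<noteq> 0} \<subseteq> fst ` {P \<in> torus. laurent_eval f P \<noteq> 0}"
  proof
    fix x assume "x \<in> {x. x \<noteq> 0 \<and> poly (p j) x \<noteq> 0}"
    then have x: "x \<noteq> 0" "r x \<noteq> 0" using coeffr[of x] by auto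
    have "0 < card {y. y \<noteq> 0 \<and> poly (r x) y \<noteq> 0}"
      using poly_nonzero_on_units[OF x(2) degr] n by linarith
    then obtain y where "y \<noteq> 0" "poly (r x) y \<noteq> 0"
      by (auto simp: card_gt_0_iff)
    then have "(x, y) \<in> {P \<in> torus. laurent_eval f P \<noteq> 0}"
      using x eval by (simp add: torus_def)
    then show "x \<in> fst ` {P \<in> torus. laurent_eval f P \<noteq> 0}"
      by (rule rev_image_eqI) simp
  qed
  have "CARD('k) - 1 - m \<le> card {x. x \<noteq> 0 \<and> poly (p j) x \<noteq> 0}"
    by (rule poly_nonzero_on_units[OF pj degp])
  also have "\<dots> \<le> card (fst ` {P \<in> torus. laurent_eval f P \<noteq> 0})"
    by (rule card_mono[OF _ sub]) simp
  also have "\<dots> \<le> card {P \<in> torus. laurent_eval f P \<noteq> 0}"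
    by (rule card_image_le) simp
  finally show ?thesis .
qed

section \<open>The evaluation map and Hamming weights\<close>

lemma linear_eval_map:
  "Vector_Spaces.linear laurent_scale (*s) (eval_map :: 'k::{field,finite} laurent2 \<Rightarrow> _)"
  by unfold_locales
    (auto simp: eval_map_def vec_eq_iff laurent_eval_add laurent_eval_scale algebra_simps)

lemma hamming_weight_eval_map:
  "hamming_weight (eval_map f) = card {P \<in> torus. laurent_eval f P \<noteq> 0}"
proof -
  have "{P \<in> torus. laurent_eval f P \<noteq> 0} = Rep_torus_point ` {i. eval_map f $ i \<noteq> 0}"
    by (auto simp: eval_map_def image_iff intro: Rep_torus_point)
      (metis Rep_torus_point_cases)
  moreover have "inj_on Rep_torus_point {i. eval_map f $ i \<noteq> 0}"
    by (simp add: inj_on_def Rep_torus_point_inject)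
  ultimately show ?thesis
    by (simp add: hamming_weight_def card_image)
qed

lemma card_torus_point: "CARD('k::{field,finite} torus_point) = (CARD('k) - 1)\<^sup>2"
  using type_definition.card[OF type_definition_torus_point[where 'k='k]] card_torus by metis

section \<open>Lattice points of the trapezoid\<close>

lemma mem_trapezoid_iff:
  fixes a b n x y :: real
  assumes "0 \<le> b" "b \<le> a" "0 < n"
  shows "(x, y) \<in> convex hull {(0, 0), (a, 0), (b, n), (0, n)} \<longleftrightarrow>
    0 \<le> x \<and> 0 \<le> y \<and> y \<le> n \<and> n * x + (a - b) * y \<le> a * n"
    (is "_ \<in> ?H \<longleftrightarrow> ?R")
proof
  \<comment> \<open>Each half-plane contains all four vertices and is convex; the last one is
    bounded by the line through (a, 0) and (b, n).\<close>
  have "?H \<subseteq> {p. (1, 0) \<bullet> p \<ge> 0} \<inter> {p. (0, 1) \<bullet> p \<ge> 0} \<inter> {p. (0, 1) \<bullet> p \<le> n} \<inter>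
      {p. (n, a - b) \<bullet> p \<le> a * n}" (is "_ \<subseteq> ?T")
  proof (rule hull_minimal)
    show "convex ?T"
      by (intro convex_Int convex_halfspace_ge convex_halfspace_le)
  qed (use assms in \<open>auto simp: algebra_simps\<close>)
  moreover assume "(x, y) \<in> ?H"
  ultimately show ?R by auto
next
  assume R: ?R
  \<comment> \<open>\<open>t\<close> is the relative height, \<open>w\<close> the length of the
    horizontal slice at that height, and \<open>s\<close> the relative position of \<open>x\<close>
    in the slice. Thus (x, y) is a convex combination of a point on the left edge and a point on the
    right edge.\<close>
  define t where "t = y / n"
  define w where "w = (1 - t) * a + t * b"
  define s where "s = x / w"
  have t: "0 \<le> t" "t \<le> 1" "y = t * n" using R assms by (auto simp: t_def)
  have "n * x \<le> n * w" using R assms by (simp add: w_def t algebra_simps)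
  then have xw: "x \<le> w" using assms by simp
  have s: "0 \<le> s" "s \<le> 1" "x = s * w"
    \<comment> \<open>If w = 0, the slice is a point: then x = 0, and \<open>s\<close> is 0 because
      division by zero yields 0.\<close>
    using xw R by (cases "w = 0"; auto simp: s_def)+
  have cv: "convex ?H" by (rule convex_convex_hull)
  have v: "v \<in> ?H" if "v \<in> {(0, 0), (a, 0), (b, n), (0, n)}" for v
    using that by (rule hull_inc)
  have left: "(1 - t) *\<^sub>R (0, 0) + t *\<^sub>R (0, n) \<in> ?H"
    by (rule convexD[OF cv]) (use t v in auto)
  have right: "(1 - t) *\<^sub>R (a, 0) + t *\<^sub>R (b, n) \<in> ?H"
    by (rule convexD[OF cv]) (use t v in auto)
  have "(1 - s) *\<^sub>R ((1 - t) *\<^sub>R (0, 0) + t *\<^sub>R (0, n)) + s *\<^sub>R ((1 - t) *\<^sub>R (a, 0) + t *\<^sub>R (b, n)) \<in> ?H"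
    by (rule convexD[OF cv left right]) (use s in auto)
  also have "(1 - s) *\<^sub>R ((1 - t) *\<^sub>R (0, 0) + t *\<^sub>R (0, n)) + s *\<^sub>R ((1 - t) *\<^sub>R (a, 0) + t *\<^sub>R (b, n)) = (x, y)"
    by (simp add: s(3) t(3) w_def algebra_simps)
  finally show "(x, y) \<in> ?H" .
qed

lemma lattice_points_trapezoid:
  fixes a b n :: int
  assumes "0 \<le> b" "b \<le> a" "0 < n"
  shows "lattice_points (convex hull {(0, 0), (of_int a, 0), (of_int b, of_int n), (0, of_int n)}) =
    {(x, y). 0 \<le> x \<and> 0 \<le> y \<and> y \<le> n \<and> n * x + (a - b) * y \<le> a * n}"
proof -
  have "real_of_int n * real_of_int x + (of_int a - of_int b) * of_int y \<le> of_int a * of_int n \<longleftrightarrow>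
      n * x + (a - b) * y \<le> a * n" for x y
    by (simp flip: of_int_mult of_int_diff of_int_add)
  then show ?thesis
    using assms by (auto simp: lattice_points_def mem_trapezoid_iff)
qed

text \<open>After cancelling g = gcd d n, the condition says that k = n / g divides
  \<open>y\<close>. The solutions are k * i with i from 0 to \<open>g\<close>, both ends included,
  whence the + 1.\<close>

lemma card_dvd_multiples:
  fixes d n :: int
  assumes "0 < n"
  shows "int (card {y \<in> {0..n}. n dvd d * y}) = gcd d n + 1"
proof -
  define g where "g = gcd d n"
  define k where "k = n div g"
  have g: "0 < g" "n = k * g" using assms by (auto simp: g_def k_def)
  have k: "0 < k" using g assms by (simp add: zero_less_mult_iff)
  have "n dvd d * y \<longleftrightarrow> k dvd y" for y
  proof -
    have "d = (d div g) * g" by (simp add: g_def)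
    moreover have "coprime (d div g) k"
      unfolding g_def k_def by (rule div_gcd_coprime) (use assms in auto)
    ultimately have "n dvd d * y \<longleftrightarrow> k * g dvd (d div g * y) * g"
      using g by (metis mult.assoc mult.commute)
    also have "\<dots> \<longleftrightarrow> k dvd d div g * y" using g by simp
    also have "\<dots> \<longleftrightarrow> k dvd y"
      using \<open>coprime (d div g) k\<close> by (simp add: coprime_commute coprime_dvd_mult_right_iff)
    finally show ?thesis .
  qed
  then have "{y \<in> {0..n}. n dvd d * y} = (\<lambda>i. k * i) ` {0..g}"
    using k g by (auto simp: dvd_def zero_le_mult_iff mult.commute)
  moreover have "inj_on (\<lambda>i. k * i) {0..g}" using k by (auto simp: inj_on_def)
  ultimately have "int (card {y \<in> {0..n}. n dvd d * y}) = g + 1"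
    using g(1) by (simp only: card_image) simp
  then show ?thesis by (simp only: g_def)
qed

text \<open>The fractions d * y / n and d * (n - y) / n add up to \<open>d\<close>, so their floors
  add up to \<open>d\<close> if both are integers and to d - 1 otherwise. The integral cases are
  counted by \<open>card_dvd_multiples\<close>.\<close>

lemma sum_floor_multiples:
  fixes d n :: int
  assumes "0 < n"
  shows "2 * (\<Sum>y\<in>{0..n}. d * y div n) = (n + 1) * (d - 1) + gcd d n + 1"
proof -
  have flip: "(\<Sum>y\<in>{0..n}. d * y div n) = (\<Sum>y\<in>{0..n}. d * (n - y) div n)"
    by (rule sum.reindex_bij_witness[of _ "\<lambda>y. n - y" "\<lambda>y. n - y"]) auto
  have pair: "d * y div n + d * (n - y) div n = d - 1 + (if n dvd d * y then 1 else 0)" for y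
  proof -
    have "d * (n - y) = - (d * y) + d * n" by (simp add: algebra_simps)
    then have "d * (n - y) div n = d + - (d * y) div n"
      using assms by (simp only: div_mult_self1)
    then show ?thesis
      using assms by (auto simp: zdiv_zminus1_eq_if dvd_eq_mod_eq_0)
  qed
  have "2 * (\<Sum>y\<in>{0..n}. d * y div n) = (\<Sum>y\<in>{0..n}. d * y div n + d * (n - y) div n)"
    unfolding sum.distrib flip[symmetric] by simp
  also have "\<dots> = (\<Sum>y\<in>{0..n}. d - 1 + (if n dvd d * y then 1 else 0))"
    by (simp add: pair)
  also have "\<dots> = (n + 1) * (d - 1) + int (card {y \<in> {0..n}. n dvd d * y})"
    using assms by (simp add: sum.distrib sum.inter_filter[symmetric])
  finally show ?thesis
    unfolding card_dvd_multiples[OF assms] by simp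
qed

lemma card_trapezoid:
  fixes a b n :: int
  assumes "0 \<le> b" "b \<le> a" "0 < n"
  shows "2 * int (card {(x, y). 0 \<le> x \<and> 0 \<le> y \<and> y \<le> n \<and> n * x + (a - b) * y \<le> a * n}) =
    (n + 1) * (a + b + 1) + gcd (a - b) n + 1" (is "2 * int (card ?U) = _")
proof -
  define d where "d = a - b"
  \<comment> \<open>Here \<open>y\<close> is the depth below the top edge: the row at height n - y
    runs from 0 to \<open>h y\<close>. Counting from the top makes the slope term positive, in the
    form that \<open>sum_floor_multiples\<close> sums.\<close>
  define h where "h y = b + d * y div n" for y
  have h: "n * x + d * (n - y) \<le> a * n \<longleftrightarrow> x \<le> h y" for x y
  proof -
    have "n * x + d * (n - y) \<le> a * n \<longleftrightarrow> (x - b) * n \<le> d * y"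
      by (simp add: d_def algebra_simps)
    also have "\<dots> \<longleftrightarrow> x - b \<le> d * y div n"
    proof
      assume "(x - b) * n \<le> d * y"
      then show "x - b \<le> d * y div n"
        using zdiv_mono1[of "(x - b) * n" "d * y" n] assms by simp
    next
      assume "x - b \<le> d * y div n"
      then have "(x - b) * n \<le> d * y div n * n" using assms by simp
      also have "\<dots> \<le> d * y" using assms 
        by (simp add: minus_mod_eq_div_mult[symmetric])
      finally show "(x - b) * n \<le> d * y" .
    qed
    finally show ?thesis by (auto simp: h_def)
  qed
  have h': "n * x + d * y \<le> a * n \<longleftrightarrow> x \<le> h (n - y)" for x y
    using h[of x "n - y"] by simp
  have bij: "bij_betw (\<lambda>(y, x). (x, n - y)) (SIGMA y:{0..n}. {0..h y}) ?U"
    by (rule bij_betwI[of _ _ _ "\<lambda>(x, y). (n - y, x)"])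
      (use h h' in \<open>auto simp: d_def\<close>)
  \<comment> \<open>Every row is non-empty, so its size is exactly h y + 1, without truncation at
    0.\<close>
  have h0: "0 \<le> h y" if "0 \<le> y" for y
    using that assms by (auto simp: h_def d_def pos_imp_zdiv_nonneg_iff intro!: add_nonneg_nonneg)
  have "int (card ?U) = (\<Sum>y\<in>{0..n}. int (card {0..h y}))"
    unfolding bij_betw_same_card[OF bij, symmetric]
    by (subst card_SigmaI) (simp_all del: card_atLeastAtMost_int)
  also have "\<dots> = (\<Sum>y\<in>{0..n}. b + 1 + d * y div n)"
    using h0 by (intro sum.cong) (auto simp: h_def)
  also have "\<dots> = (n + 1) * (b + 1) + (\<Sum>y\<in>{0..n}. d * y div n)"
    using assms by (simp add: sum.distrib)
  finally have "2 * int (card ?U) = 2 * (n + 1) * (b + 1) + 2 * (\<Sum>y\<in>{0..n}. d * y div n)"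
    by simp
  also have "\<dots> = 2 * (n + 1) * (b + 1) + (n + 1) * (d - 1) + gcd d n + 1"
    by (simp only: sum_floor_multiples[OF assms(3)])
  finally show ?thesis by (simp add: d_def algebra_simps)
qed

section \<open>Parameters of the toric code of the trapezoid\<close>

theorem theorem3p2:
  fixes a b :: int and q :: nat
    and S :: "(real \<times> real) set"
    and U :: "(int \<times> int) set"
    and C :: "('k::{field,finite} ^ 'k torus_point) set"
  assumes q: "CARD('k) = q"
    and ab: "0 \<le> b" "b \<le> a" "a \<le> int q - 2"
    and S: "S = convex hull {(0, 0), (of_int a, 0), (of_int b, real q - 2), (0, real q - 2)}"
    and U: "U = lattice_points S"
    and C: "C = toric_code S"
  shows "(\<forall>f :: 'k laurent2. f \<in> laurent_span U \<longrightarrow> f \<noteq> 0 \<longrightarrow>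
            int (card {P \<in> torus. laurent_eval f P = 0}) \<le> (int q - 1)^2 - (int q - 1 - a)) \<and>
         int (code_length C) = (int q - 1)^2 \<and>
         vec.dim C = card U \<and>
         real (card U) =
           of_int ((int q - 1) * (a + b + 1) + gcd (a - b) (int q - 2) + 1) / 2 \<and>
         int (min_distance C) \<ge> int q - 1 - a"
proof -
  define n where "n = int q - 2"
  have n0: "0 \<le> n" using ab by (simp add: n_def)
  have S': "S = convex hull {(0, 0), (of_int a, 0), (of_int b, of_int n), (0, of_int n)}"
    by (simp add: S n_def)
  have U_count: "U \<subseteq> {0..a} \<times> {0..n} \<and> (0, 0) \<in> U \<and>
      2 * int (card U) = (n + 1) * (a + b + 1) + gcd (a - b) n + 1"
  \<comment> \<open>For q = 2 the trapezoid collapses to the origin. The formula still gives one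
    point, since gcd 0 0 = 0.\<close>
  proof (cases "n = 0")
    case True
    then have "a = 0" "b = 0" using ab by (auto simp: n_def)
    with True have "S = {(0, 0)}" by (simp add: S')
    then have "U = {(0, 0)}" by (auto simp: U lattice_points_def)
    then show ?thesis using True \<open>a = 0\<close> \<open>b = 0\<close> by simp
  next
    case False
    then have n: "0 < n" using n0 by simp
    have U': "U = {(x, y). 0 \<le> x \<and> 0 \<le> y \<and> y \<le> n \<and> n * x + (a - b) * y \<le> a * n}"
      unfolding U S' by (rule lattice_points_trapezoid[OF ab(1,2) n])
    have "x \<le> a" if "n * x + (a - b) * y \<le> a * n" "0 \<le> y" for x y
    proof -
      have "0 \<le> (a - b) * y" using that ab by simp
      then have "n * x \<le> n * a" using that by (simp add: mult.commute)
      then show ?thesis using n by simp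
    qed
    then have "U \<subseteq> {0..a} \<times> {0..n}" by (auto simp: U')
    moreover have "(0, 0) \<in> U" using ab n by (simp add: U')
    ultimately show ?thesis
      using card_trapezoid[OF ab(1,2) n] unfolding U' by simp
  qed
  have finU: "finite U"
    using U_count by (meson finite_SigmaI finite_atLeastAtMost_int finite_subset)
  have ge: "int q - 1 - a \<le> int (card {P \<in> torus. laurent_eval f P \<noteq> 0})"
    if f: "f \<in> laurent_span U" "f \<noteq> 0" for f :: "'k laurent2"
  proof -
    have "Poly_Mapping.keys f \<subseteq> {0..int (nat a)} \<times> {0..int (nat n)}"
      using keys_laurent_span[OF f(1)] U_count ab n0 by auto
    moreover have "nat n + 1 < CARD('k)" using n0 by (auto simp: q n_def)
    ultimately have "CARD('k) - 1 - nat a \<le> card {P \<in> torus. laurent_eval f P \<noteq> 0}"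
      by (rule laurent_nonzeros_ge[OF f(2)])
    then show ?thesis using ab q by linarith
  qed
  have torus: "int (card (torus :: ('k \<times> 'k) set)) = (int q - 1)\<^sup>2"
    using ab by (simp add: card_torus q of_nat_diff)
  have zeros: "int (card {P \<in> torus. laurent_eval f P = 0}) \<le> (int q - 1)\<^sup>2 - (int q - 1 - a)"
    if f: "f \<in> laurent_span U" "f \<noteq> 0" for f :: "'k laurent2"
  proof -
    have "(torus :: ('k \<times> 'k) set) =
        {P \<in> torus. laurent_eval f P = 0} \<union> {P \<in> torus. laurent_eval f P \<noteq> 0}" by auto
    then have "card (torus :: ('k \<times> 'k) set) =
        card {P \<in> torus. laurent_eval f P = 0} + card {P \<in> torus. laurent_eval f P \<noteq> 0}"
      by (subst card_Un_disjoint[symmetric]) auto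
    then show ?thesis using ge[OF f] torus by linarith
  qed
  have len: "int (code_length C) = (int q - 1)\<^sup>2"
    using torus by (simp add: code_length_def card_torus_point card_torus)
  interpret ev: Vector_Spaces.linear laurent_scale "(*s)" "eval_map :: 'k laurent2 \<Rightarrow> _"
    by (rule linear_eval_map)
  have C': "C = eval_map ` laurent_span U" by (simp add: C U toric_code_def)
  have inj: "inj_on eval_map (laurent_span U :: 'k laurent2 set)"
  proof -
    \<comment> \<open>The kernel on the span is trivial: by \<open>ge\<close> a non-zero
      \<open>f\<close> has weight at least q - 1 - a, which is at least 1.\<close>
    have "f = 0" if "f \<in> laurent_span U" "eval_map f = 0" for f :: "'k laurent2"
    proof (rule ccontr)
      assume "f \<noteq> 0"
      then have "0 < hamming_weight (eval_map f)"
        using ge[OF that(1)] ab by (simp add: hamming_weight_eval_map)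
      then show False using that by (simp add: hamming_weight_def)
    qed
    then show ?thesis
      unfolding laurent_span_def
      by (subst ev.inj_on_iff_eq_0) (auto simp: laurent.subspace_span)
  qed
  let ?M = "laurent_monom ` U :: 'k laurent2 set"
  have "vec.dim C = card (eval_map ` ?M)"
  proof -
    \<comment> \<open>Injectivity on the span carries the monomial basis to a basis of the
      code.\<close>
    have "C = vec.span (eval_map ` ?M)"
      unfolding C' laurent_span_def by (rule ev.span_image[symmetric])
    moreover have "vec.independent (eval_map ` ?M)"
      using inj unfolding laurent_span_def
      by (intro ev.independent_injective_image independent_laurent_monoms)
    ultimately show ?thesis by (simp add: vec.dim_eq_card_independent)
  qed
  also have "\<dots> = card ?M"
  proof (rule card_image)
    show "inj_on eval_map ?M"
      by (rule inj_on_subset[OF inj]) (simp add: laurent_span_def laurent.span_superset)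
  qed
  also have "\<dots> = card U"
    using inj_laurent_monom by (intro card_image) (auto simp: inj_def inj_on_def)
  finally have dim: "vec.dim C = card U" .
  have count: "real (card U) =
      of_int ((int q - 1) * (a + b + 1) + gcd (a - b) (int q - 2) + 1) / 2"
  proof -
    have "2 * int (card U) = (int q - 1) * (a + b + 1) + gcd (a - b) (int q - 2) + 1"
      using U_count by (simp add: n_def)
    then have "real_of_int (2 * int (card U)) =
        of_int ((int q - 1) * (a + b + 1) + gcd (a - b) (int q - 2) + 1)"
      by (simp only:)
    then show ?thesis by simp
  qed
  \<comment> \<open>An infimum of naturals is attained on a non-empty set, so it is enough to bound
    the weight of a single codeword.\<close>
  have "min_distance C \<in> hamming_weight ` (C - {0})"
    unfolding min_distance_def
  proof (rule Inf_nat_def1)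
    \<comment> \<open>The constant polynomial 1 evaluates to the all-ones vector, a non-zero
      codeword.\<close>
    have "laurent_monom (0, 0) \<in> (laurent_span U :: 'k laurent2 set)"
      using U_count by (auto simp: laurent_span_def intro: laurent.span_base)
    moreover have "eval_map (laurent_monom (0, 0) :: 'k laurent2) \<noteq> 0"
      by (auto simp: eval_map_def laurent_monom_def laurent_eval_def vec_eq_iff)
    ultimately show "hamming_weight ` (C - {0}) \<noteq> {}" by (auto simp: C')
  qed
  then obtain f :: "'k laurent2" where
    f: "f \<in> laurent_span U" "eval_map f \<noteq> 0" "min_distance C = hamming_weight (eval_map f)"
    by (auto simp: C')
  have "f \<noteq> 0" using f(2) ev.zero by auto
  then have "int q - 1 - a \<le> int (min_distance C)"
    using ge[OF f(1)] f(3) by (simp add: hamming_weight_eval_map)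
  with zeros len dim count show ?thesis by blast
qed

end
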